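(* Let $\tilde f:[0,\infty)\to\mathbb{R}$ be a convex function and let $c>0$. Run the procedure quasi_exact_line_search (described in the context) on $\tilde f$ and $c$, and let $\alpha_c$ be the value it returns. Let $\alpha_\infty\in\operatorname{argmin}_{\alpha\ge0}\tilde f(\alpha)$, and assume $\alpha_\infty<\infty$ and $\tilde f(\infty)>\tilde f(\alpha_\infty)$, where $\tilde f(\infty)=\lim_{\alpha\to\infty}\tilde f(\alpha)$. Then $$\tilde f(0)-\tilde f(\alpha_c)\ \ge\ \frac{c}{c+1}\left(\tilde f(0)-\tilde f(\alpha_\infty)\right).$$
   Context: For a finite set $P$ of points on the graph of $\tilde f$, let $p^{\text{low}}(P)=(x^{\text{low}}(P),y^{\text{low}}(P))$ be a point of $P$ with smallest $y$-coordinate. For points $p^i=(x^i,y^i)$ and $p^j=(x^j,y^j)$ with $x^i\ne x^j$, let $f^{ij}(x)=\frac{y^i-y^j}{x^i-x^j}(x-x^i)+y^i$ be the line through them. Define $$\Delta(P)=\Big\{(x,y)\in\mathbb{R}^2 :\ x\in\big[\min_{(x',y')\in P}x',\ \max_{(x',y')\in P}x'\big],\ \ y\le y^{\text{low}}(P),\ \ f^{ij}(x)\le y\ \text{ for all } p^i,p^j\in P \text{ with } x^i<x^j \text{ and } x\notin(x^i,x^j)\Big\},$$ $\Delta^x(P)=\{x : (x,y)\in\Delta(P)\text{ for some }y\}$, $\Delta^y(P)=\{y : (x,y)\in\Delta(P)\text{ for some }x\}$, and $|S|=\sup S-\inf S$ (possibly $\infty$). Core loop ($\Delta$-Secant_core),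 with fixed $\varepsilon\in(0,\frac12)$ and a stopping predicate: starting from a given finite set $Q_1$ of points on the graph of $\tilde f$, at iteration $t=1,2,\dots$: if the stopping predicate holds for $Q_t$, return $Q_t$. Otherwise let $x^-=\inf\Delta^x(Q_t)$, $x^+=\sup\Delta^x(Q_t)$, $x^m=(x^-+x^+)/2$; set $x^q=x^m+\varepsilon(x^+-x^-)$ if $x^m$ is already the abscissa of a point of $Q_t$, and $x^q=x^m$ otherwise; set $Q_{t+1}=Q_t\cup\{(x^q,\tilde f(x^q))\}$. Procedure quasi_exact_line_search, with inputs $\tilde f$, $c>0$ and an initial step $\alpha_{\text{prev}}>0$ (default $1$): the stopping predicate for a set $P$ is $c\,|\Delta^y(P)|\le\tilde f(0)-y^{\text{low}}(P)$. Start with $P_0=\{(0,\tilde f(0))\}$. For $i=0,1,2,\dots$: let $x^{\text{right}}=4^i\alpha_{\text{prev}}$ and $P_i'=P_i\cup\{(x^{\text{right}},\tilde f(x^{\text{right}}))\}$; let $P_{i+1}$ be the output of the core loop started from $P_i'$ with the stopping predicate $c\,|\Delta^y(P)|\le\tilde f(0)-y^{\text{low}}(P)$; if $x^{\text{low}}(P_{i+1})<x^{\text{right}}$, return $x^{\text{low}}(P_{i+1})$; otherwise continue with the next $i$. *)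

theory Defs
  imports "HOL-Analysis.Analysis"
begin

type_synonym point = "real \<times> real"

text \<open>
  A point set \<open>P\<close> may have several lowest points. The ordinate \<open>y_low P\<close> does not depend on the
  choice, the abscissa does; \<open>lowest P\<close> therefore relates \<open>P\<close> to each admissible choice, and the
  procedures below are relations between inputs and possible outputs.
\<close>

definition lowest :: "point set \<Rightarrow> point \<Rightarrow> bool" where
  "lowest P p \<longleftrightarrow> is_arg_min snd (\<lambda>q. q \<in> P) p"

definition y_low :: "point set \<Rightarrow> real" where
  "y_low P = Min (snd ` P)"

definition secant :: "point \<Rightarrow> point \<Rightarrow> real \<Rightarrow> real" where
  "secant p q x = (snd p - snd q) / (fst p - fst q) * (x - fst p) + snd p"

definition Delta :: "point set \<Rightarrow> point set" where
  "Delta P = {(x, y). x \<in> {Min (fst ` P)..Max (fst ` P)} \<and> y \<le> y_low P \<and>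
     (\<forall>p\<in>P. \<forall>q\<in>P. fst p < fst q \<and> x \<notin> {fst p<..<fst q} \<longrightarrow> secant p q x \<le> y)}"

definition Delta_x :: "point set \<Rightarrow> real set" where
  "Delta_x P = {x. \<exists>y. (x, y) \<in> Delta P}"

definition Delta_y :: "point set \<Rightarrow> real set" where
  "Delta_y P = {y. \<exists>x. (x, y) \<in> Delta P}"

text \<open>Supremum and infimum are taken in the extended reals, since \<open>Delta_y P\<close> may be unbounded below.\<close>

definition extent :: "real set \<Rightarrow> ereal" where
  "extent S = (SUP s\<in>S. ereal s) - (INF s\<in>S. ereal s)"

text \<open>
  \<open>Delta_x P\<close> is bounded, and it is nonempty when \<open>P\<close> is a nonempty finite set of points on the graph
  of a convex function, so the real-valued \<open>Inf\<close> and \<open>Sup\<close> are the intended ones.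
\<close>

definition next_abscissa :: "real \<Rightarrow> point set \<Rightarrow> real" where
  "next_abscissa \<epsilon> Q =
    (let a = Inf (Delta_x Q); b = Sup (Delta_x Q); m = (a + b) / 2
     in if m \<in> fst ` Q then m + \<epsilon> * (b - a) else m)"

text \<open>
  \<open>secant_core f \<epsilon> stop Q R\<close>: the loop started from \<open>Q\<close> terminates and returns \<open>R\<close>.
  An infinite run relates \<open>Q\<close> to nothing.
\<close>

inductive secant_core ::
  "(real \<Rightarrow> real) \<Rightarrow> real \<Rightarrow> (point set \<Rightarrow> bool) \<Rightarrow> point set \<Rightarrow> point set \<Rightarrow> bool"
  for f :: "real \<Rightarrow> real" and \<epsilon> :: real and stop :: "point set \<Rightarrow> bool"
where
  halt: "stop Q \<Longrightarrow> secant_core f \<epsilon> stop Q Q"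
| step: "\<not> stop Q \<Longrightarrow> x = next_abscissa \<epsilon> Q \<Longrightarrow> secant_core f \<epsilon> stop (Q \<union> {(x, f x)}) R
    \<Longrightarrow> secant_core f \<epsilon> stop Q R"

definition stop_criterion :: "(real \<Rightarrow> real) \<Rightarrow> real \<Rightarrow> point set \<Rightarrow> bool" where
  "stop_criterion f c P \<longleftrightarrow> ereal c * extent (Delta_y P) \<le> ereal (f 0 - y_low P)"

text \<open>
  \<open>line_search_loop f c \<epsilon> \<alpha>\<^sub>p i P \<alpha>\<close>: the outer loop with initial step \<open>\<alpha>\<^sub>p\<close>, entered at index \<open>i\<close>
  with point set \<open>P\<close>, terminates and can return \<open>\<alpha>\<close>.
\<close>

inductive line_search_loop ::
  "(real \<Rightarrow> real) \<Rightarrow> real \<Rightarrow> real \<Rightarrow> real \<Rightarrow> nat \<Rightarrow> point set \<Rightarrow> real \<Rightarrow> bool"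
  for f :: "real \<Rightarrow> real" and c \<epsilon> \<alpha>\<^sub>p :: real
where
  finish: "x = 4 ^ i * \<alpha>\<^sub>p \<Longrightarrow> secant_core f \<epsilon> (stop_criterion f c) (P \<union> {(x, f x)}) P'
    \<Longrightarrow> lowest P' p \<Longrightarrow> fst p < x \<Longrightarrow> line_search_loop f c \<epsilon> \<alpha>\<^sub>p i P (fst p)"
| extend: "x = 4 ^ i * \<alpha>\<^sub>p \<Longrightarrow> secant_core f \<epsilon> (stop_criterion f c) (P \<union> {(x, f x)}) P'
    \<Longrightarrow> lowest P' p \<Longrightarrow> \<not> fst p < x \<Longrightarrow> line_search_loop f c \<epsilon> \<alpha>\<^sub>p (Suc i) P' \<alpha>
    \<Longrightarrow> line_search_loop f c \<epsilon> \<alpha>\<^sub>p i P \<alpha>"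

definition quasi_exact_line_search ::
  "(real \<Rightarrow> real) \<Rightarrow> real \<Rightarrow> real \<Rightarrow> real \<Rightarrow> real \<Rightarrow> bool" where
  "quasi_exact_line_search f c \<epsilon> \<alpha>\<^sub>p \<alpha> \<longleftrightarrow> line_search_loop f c \<epsilon> \<alpha>\<^sub>p 0 {(0, f 0)} \<alpha>"

end

theory Submission
  imports Defs
begin

text \<open>
  Convex functions lie above their secants outside the interpolation interval, so \<open>Delta P\<close>
  contains the graph point of every minimiser within the range of \<open>P\<close>, as well as the lowest point
  of \<open>P\<close>. Hence the stopping criterion gives \<open>c (y_low P - f \<alpha>_inf) \<le> f 0 - y_low P\<close>, which
  rearranges to the claim. If the minimiser lies to the right of the range, then
  \<open>x_low P < x_right\<close> forces \<open>f\<close> to be constant on \<open>[x_low P, \<alpha>_inf]\<close>, and the step is optimal.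
\<close>

text \<open>Jensen's inequality at \<open>b\<close>, multiplied through by \<open>d - a\<close>.
  Free of division, it also covers \<open>a = d\<close>, and its uses reduce to rearranging
  terms.\<close>

lemma convex_on_three_points:
  fixes f :: "real \<Rightarrow> real"
  assumes "convex_on S f" and "a \<in> S" "d \<in> S" and "a \<le> b" "b \<le> d"
  shows "(d - a) * f b \<le> (d - b) * f a + (b - a) * f d"
proof (cases "a = d")
  case False
  define t where "t = (b - a) / (d - a)"
  have "d - a > 0"
    using assms False by simp
  then have t: "0 \<le> t" "t \<le> 1" "(d - a) * t = b - a"
    using assms by (simp_all add: t_def)
  then have b: "b = (1 - t) * a + t * d"
    by (simp add: algebra_simps)
  have "f b \<le> (1 - t) * f a + t * f d"
    using convex_onD[OF assms(1) t(1,2) assms(2,3)] b by simp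
  then have "(d - a) * f b \<le> (d - a) * ((1 - t) * f a + t * f d)"
    using \<open>d - a > 0\<close> by (simp add: mult_left_mono)
  also have "\<dots> = ((d - a) - (d - a) * t) * f a + (d - a) * t * f d"
    by (simp add: algebra_simps)
  also have "\<dots> = (d - b) * f a + (b - a) * f d"
    using t(3) by simp
  finally show ?thesis .
qed (use assms in simp)

text \<open>Outside the open interval, one of the nodes \<open>a\<close>, \<open>b\<close> lies
  between \<open>x\<close> and the other node; convexity is applied at that middle node.\<close>

lemma secant_le_convex:
  fixes f :: "real \<Rightarrow> real"
  assumes "convex_on S f" and "a \<in> S" "b \<in> S" "x \<in> S" and "a < b" "x \<notin> {a<..<b}"
  shows "secant (a, f a) (b, f b) x \<le> f x"
proof -
  have "(f b - f a) * (x - a) \<le> (f x - f a) * (b - a)"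
  proof (cases "x \<le> a")
    case True
    then show ?thesis
      using convex_on_three_points[OF assms(1), of x b a] assms by (simp add: algebra_simps)
  next
    case False
    then show ?thesis
      using convex_on_three_points[OF assms(1), of a x b] assms by (simp add: algebra_simps)
  qed
  then have "(f b - f a) * (x - a) / (b - a) \<le> f x - f a"
    using assms by (simp add: pos_divide_le_eq)
  moreover have "(f a - f b) / (a - b) = (f b - f a) / (b - a)"
    by (metis minus_diff_eq minus_divide_divide)
  ultimately show ?thesis
    by (simp add: secant_def)
qed

lemma lowest_iff: "lowest P p \<longleftrightarrow> p \<in> P \<and> (\<forall>q\<in>P. snd p \<le> snd q)"
  by (auto simp: lowest_def is_arg_min_def not_less)

lemma y_low_eq:
  assumes "finite P" and "lowest P p"
  shows "y_low P = snd p"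
  using assms unfolding y_low_def lowest_iff by (intro Min_eqI) auto

text \<open>Invariant of both loops. It does not include \<open>(X, f X)\<close>, because the outer
  loop enters a round before the new right end is evaluated; at that moment \<open>X\<close> only
  bounds the abscissae.\<close>

definition samples :: "(real \<Rightarrow> real) \<Rightarrow> real \<Rightarrow> point set \<Rightarrow> bool" where
  "samples f X P \<longleftrightarrow> finite P \<and> P \<subseteq> (\<lambda>x. (x, f x)) ` {0..X} \<and> (0, f 0) \<in> P"

lemma Delta_graph:
  assumes "convex_on {0..} f" and "samples f X P" and "(X, f X) \<in> P"
    and "x \<in> {0..X}" and "f x \<le> y_low P"
  shows "(x, f x) \<in> Delta P"
proof -
  have P: "finite P" "\<And>p. p \<in> P \<Longrightarrow> 0 \<le> fst p \<and> p = (fst p, f (fst p))"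
    using assms(2) by (auto simp: samples_def)
  \<comment> \<open>The points over 0 and \<open>X\<close> make the range of abscissae of
    \<open>P\<close> all of \<open>{0..X}\<close>.\<close>
  have "Min (fst ` P) \<le> 0" "X \<le> Max (fst ` P)"
    using assms(2,3) by (force simp: samples_def intro: Min_le Max_ge)+
  moreover have "secant p q x \<le> f x"
    if "p \<in> P" "q \<in> P" "fst p < fst q" "x \<notin> {fst p<..<fst q}" for p q
    using secant_le_convex[OF assms(1), of "fst p" "fst q" x] that P(2)[of p] P(2)[of q] assms(4)
    by auto
  ultimately show ?thesis
    using assms(4,5) by (auto simp: Delta_def)
qed

lemma Delta_x_subset:
  assumes "samples f X P"
  shows "Delta_x P \<subseteq> {0..X}"
proof -
  have P: "finite (fst ` P)" "fst ` P \<noteq> {}" "fst ` P \<subseteq> {0..X}"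
    using assms by (auto simp: samples_def)
  then have "Min (fst ` P) \<in> {0..X}" "Max (fst ` P) \<in> {0..X}"
    using Min_in Max_in by blast+
  then show ?thesis
    by (auto simp: Delta_x_def Delta_def)
qed

lemma samples_lowest:
  assumes "samples f X P"
  obtains x where "x \<in> {0..X}" "(x, f x) \<in> P" "f x = y_low P"
proof -
  have P: "finite (snd ` P)" "snd ` P \<noteq> {}"
    using assms by (auto simp: samples_def)
  obtain p where "p \<in> P" "y_low P = snd p"
    using Min_in[OF P] by (auto simp: y_low_def)
  then show thesis
    using assms that by (auto simp: samples_def)
qed

text \<open>Keeps the core loop inside the domain on which \<open>f\<close> is convex. The lowest
  point of \<open>P\<close> makes \<open>Delta_x P\<close> nonempty, so its \<open>Inf\<close> and
  \<open>Sup\<close> are genuine bounds within \<open>{0..X}\<close>.\<close>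

lemma next_abscissa_in_range:
  assumes "convex_on {0..} f" and "samples f X P" and "(X, f X) \<in> P"
    and "0 < \<epsilon>" "\<epsilon> < 1 / 2"
  shows "next_abscissa \<epsilon> P \<in> {0..X}"
proof -
  let ?a = "Inf (Delta_x P)" and ?b = "Sup (Delta_x P)"
  obtain x where "x \<in> {0..X}" "f x = y_low P"
    using assms(2) by (rule samples_lowest)
  then have x: "x \<in> Delta_x P"
    using Delta_graph[OF assms(1-3)] by (force simp: Delta_x_def)
  have sub: "Delta_x P \<subseteq> {0..X}"
    by (rule Delta_x_subset[OF assms(2)])
  have "0 \<le> ?a"
    using x sub by (intro cInf_greatest) auto
  moreover have "?b \<le> X"
    using x sub by (intro cSup_least) auto
  moreover have "?a \<le> x"
    using x sub by (intro cInf_lower bdd_belowI[of _ 0]) auto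
  moreover have "x \<le> ?b"
    using x sub by (intro cSup_upper bdd_aboveI[of _ X]) auto
  \<comment> \<open>The shift away from the midpoint is at most half the length, so the new abscissa
    does not pass \<open>?b\<close>.\<close>
  moreover have "0 \<le> \<epsilon> * (?b - ?a)" "\<epsilon> * (?b - ?a) \<le> 1 / 2 * (?b - ?a)"
    using assms(4,5) \<open>?a \<le> x\<close> \<open>x \<le> ?b\<close> by (simp, intro mult_right_mono) auto
  ultimately show ?thesis
    unfolding next_abscissa_def Let_def by auto
qed

lemma samples_insert:
  assumes "samples f X P" and "X \<le> Y" and "x \<in> {0..Y}"
  shows "samples f Y (P \<union> {(x, f x)})"
  using assms by (fastforce simp: samples_def)

lemma secant_core_samples:
  assumes "secant_core f \<epsilon> stop Q R"
    and "convex_on {0..} f" and "0 < \<epsilon>" "\<epsilon> < 1 / 2"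
    and "samples f X Q" and "(X, f X) \<in> Q"
  shows "samples f X R \<and> (X, f X) \<in> R \<and> stop R"
  using assms
proof (induction rule: secant_core.induct)
  case (step Q x R)
  then have "x \<in> {0..X}"
    using next_abscissa_in_range by blast
  then show ?case
    using step samples_insert[of f X Q X x] by auto
qed auto

text \<open>Both \<open>y_low P\<close> and \<open>f m\<close> are ordinates in
  \<open>Delta_y P\<close>, so their distance is at most its extent. The comparison is made in
  \<open>ereal\<close>, where it also holds for an infinite extent.\<close>

lemma stop_criterion_gap:
  assumes "convex_on {0..} f" and "samples f X P" and "(X, f X) \<in> P"
    and "c > 0" and "stop_criterion f c P" and "m \<in> {0..X}" and "f m \<le> y_low P"
  shows "c * (y_low P - f m) \<le> f 0 - y_low P"
proof -
  obtain x where "x \<in> {0..X}" "f x = y_low P"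
    using assms(2) by (rule samples_lowest)
  then have "y_low P \<in> Delta_y P" "f m \<in> Delta_y P"
    using Delta_graph[OF assms(1-3)] assms(6,7) by (force simp: Delta_y_def)+
  then have "ereal (y_low P) - ereal (f m) \<le> extent (Delta_y P)"
    unfolding extent_def by (intro ereal_minus_mono SUP_upper INF_lower)
  then have "ereal c * ereal (y_low P - f m) \<le> ereal c * extent (Delta_y P)"
    using assms(4) by (intro ereal_mult_left_mono) auto
  also have "\<dots> \<le> ereal (f 0 - y_low P)"
    using assms(5) by (simp add: stop_criterion_def)
  finally show ?thesis
    by simp
qed

text \<open>Only the returning round matters: \<open>X\<close> is its right end and \<open>R\<close>
  the output of its core loop. Earlier rounds just pass the invariant on.\<close>

lemma line_search_loop_result:
  assumes "line_search_loop f c \<epsilon> \<alpha>\<^sub>p i P \<alpha>"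
    and "convex_on {0..} f" and "0 < \<epsilon>" "\<epsilon> < 1 / 2" and "\<alpha>\<^sub>p > 0"
    and "samples f (4 ^ i * \<alpha>\<^sub>p) P"
  shows "\<exists>X R. samples f X R \<and> (X, f X) \<in> R \<and> stop_criterion f c R \<and> lowest R (\<alpha>, f \<alpha>) \<and> \<alpha> < X"
  using assms
proof (induction rule: line_search_loop.induct)
  case (finish x i P P' p)
  have R: "samples f x P' \<and> (x, f x) \<in> P' \<and> stop_criterion f c P'"
    using finish samples_insert[of f x P x x] by (intro secant_core_samples[OF finish.hyps(2)]) auto
  moreover have "p = (fst p, f (fst p))"
    using R finish.hyps(3) by (auto simp: samples_def lowest_iff)
  ultimately show ?case
    using finish.hyps(3,4) by metis
next
  case (extend x i P P' p \<alpha>)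
  have "samples f x P'"
    using extend samples_insert[of f x P x x] secant_core_samples by auto
  \<comment> \<open>The bound on the abscissae may be enlarged, here by the factor 4.\<close>
  then have "samples f (4 ^ Suc i * \<alpha>\<^sub>p) P'"
    using extend.hyps(1) \<open>\<alpha>\<^sub>p > 0\<close> by (fastforce simp: samples_def)
  then show ?case
    using extend by blast
qed

theorem theorem12:
  fixes f :: "real \<Rightarrow> real" and c \<epsilon> \<alpha>_prev \<alpha>_c \<alpha>_inf :: real and f_inf :: ereal
  assumes "convex_on {0..} f"
    and "c > 0"
    and "0 < \<epsilon>" and "\<epsilon> < 1 / 2"
    and "\<alpha>_prev > 0"
    and "quasi_exact_line_search f c \<epsilon> \<alpha>_prev \<alpha>_c"
    and "is_arg_min f (\<lambda>\<alpha>. 0 \<le> \<alpha>) \<alpha>_inf"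
    and "((\<lambda>\<alpha>. ereal (f \<alpha>)) \<longlongrightarrow> f_inf) at_top"
    and "f_inf > ereal (f \<alpha>_inf)"
  shows "f 0 - f \<alpha>_c \<ge> c / (c + 1) * (f 0 - f \<alpha>_inf)"
proof -
  have min: "0 \<le> \<alpha>_inf" "\<And>x. 0 \<le> x \<Longrightarrow> f \<alpha>_inf \<le> f x"
    using assms(7) by (auto simp: is_arg_min_def not_less)
  have "samples f (4 ^ 0 * \<alpha>_prev) {(0, f 0)}"
    using assms(5) by (auto simp: samples_def)
  then obtain X R where R: "samples f X R" "(X, f X) \<in> R" "stop_criterion f c R"
    and low: "lowest R (\<alpha>_c, f \<alpha>_c)" and "\<alpha>_c < X"
    using line_search_loop_result assms(1,3-6) unfolding quasi_exact_line_search_def by metis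
  have y: "y_low R = f \<alpha>_c"
    using y_low_eq[OF _ low] R(1) by (simp add: samples_def)
  have "0 \<le> \<alpha>_c"
    using R(1) low by (auto simp: samples_def lowest_iff)
  have "f \<alpha>_c \<le> f 0" "f \<alpha>_c \<le> f X"
    using R low by (auto simp: samples_def lowest_iff)
  have "c * (f \<alpha>_c - f \<alpha>_inf) \<le> f 0 - f \<alpha>_c"
  proof (cases "\<alpha>_inf \<le> X")
    case True
    then show ?thesis
      using stop_criterion_gap[OF assms(1) R(1,2) assms(2) R(3), of \<alpha>_inf] y min \<open>0 \<le> \<alpha>_c\<close> by simp
  next
    case False
    \<comment> \<open>Convexity at \<open>X\<close>, which lies between \<open>\<alpha>_c\<close>
      and \<open>\<alpha>_inf\<close>. Bounding \<open>f X\<close> below by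
      \<open>f \<alpha>_c\<close> then leaves both values with the common positive weight
      \<open>X - \<alpha>_c\<close>.\<close>
    then have "(\<alpha>_inf - \<alpha>_c) * f X \<le> (\<alpha>_inf - X) * f \<alpha>_c + (X - \<alpha>_c) * f \<alpha>_inf"
      using \<open>0 \<le> \<alpha>_c\<close> \<open>\<alpha>_c < X\<close> min(1) by (intro convex_on_three_points[OF assms(1)]) auto
    moreover have "(\<alpha>_inf - \<alpha>_c) * f \<alpha>_c \<le> (\<alpha>_inf - \<alpha>_c) * f X"
      using False \<open>\<alpha>_c < X\<close> \<open>f \<alpha>_c \<le> f X\<close> by (intro mult_left_mono) auto
    ultimately have "(X - \<alpha>_c) * f \<alpha>_c \<le> (X - \<alpha>_c) * f \<alpha>_inf"
      by (simp add: algebra_simps)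
    then have "f \<alpha>_c \<le> f \<alpha>_inf"
      using \<open>\<alpha>_c < X\<close> by simp
    then have "c * (f \<alpha>_c - f \<alpha>_inf) \<le> 0"
      using assms(2) by (simp add: mult_nonneg_nonpos)
    then show ?thesis
      using \<open>f \<alpha>_c \<le> f 0\<close> by linarith
  qed
  \<comment> \<open>Adds \<open>c * (f 0 - f \<alpha>_c)\<close> to both sides.\<close>
  then have "c * (f 0 - f \<alpha>_inf) \<le> (f 0 - f \<alpha>_c) * (c + 1)"
    by (simp add: algebra_simps)
  then show ?thesis
    using assms(2) by (simp add: pos_divide_le_eq)
qed

end
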